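(* Let $\mathcal{F}$ be a semigroup of transcendental entire functions. Then the generalized escaping like set $U(\mathcal{F})$ is non-empty and backward invariant. Further, if $\mathcal{F}=\langle f_1,\dots,f_m\rangle$, where $f_1,\dots,f_m$ are transcendental entire functions, then for each $z\in U(\mathcal{F})$ there exists $f_i\in\{f_1,\dots,f_m\}$ such that $f_i(z)\in U(\mathcal{F})$.
   Context: A semigroup of entire functions is a (non-empty) family of entire functions closed under composition; $\langle f_1,\dots,f_m\rangle$ denotes the semigroup generated by $f_1,\dots,f_m$ under composition. For a family $\mathcal{F}$ of entire functions, the generalized escaping like set is $U(\mathcal{F}):=\{z\in\mathbb{C}: f_n(z)\to\infty \text{ for some sequence } \{f_n\}\text{ in }\mathcal{F}\}$. A set $S\subseteq\mathbb{C}$ is backward invariant (with respect to $\mathcal{F}$) if $f^{-1}(S)\subseteq S$ for every $f\in\mathcal{F}$. *)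

theory Defs
  imports "HOL-Complex_Analysis.Complex_Analysis"
begin

definition transcendental_entire :: "(complex \<Rightarrow> complex) \<Rightarrow> bool" where
  "transcendental_entire f \<longleftrightarrow> f holomorphic_on UNIV \<and> (\<nexists>p :: complex poly. f = poly p)"

definition semigroup_entire :: "(complex \<Rightarrow> complex) set \<Rightarrow> bool" where
  "semigroup_entire F \<longleftrightarrow>
     F \<noteq> {} \<and> (\<forall>f\<in>F. f holomorphic_on UNIV) \<and> (\<forall>f\<in>F. \<forall>g\<in>F. f \<circ> g \<in> F)"

(* The identity is not adjoined: elements are compositions of at least one generator. *)
inductive_set generated_semigroup :: "('a \<Rightarrow> 'a) set \<Rightarrow> ('a \<Rightarrow> 'a) set"
  for G :: "('a \<Rightarrow> 'a) set" where
  gen: "f \<in> G \<Longrightarrow> f \<in> generated_semigroup G"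
| comp: "f \<in> generated_semigroup G \<Longrightarrow> g \<in> generated_semigroup G \<Longrightarrow>
    f \<circ> g \<in> generated_semigroup G"

(* The members of the sequence need not be distinct and need not be iterates of one function. *)
definition gen_escaping_like_set :: "(complex \<Rightarrow> complex) set \<Rightarrow> complex set" where
  "gen_escaping_like_set F =
     {z. \<exists>f :: nat \<Rightarrow> complex \<Rightarrow> complex.
           (\<forall>n. f n \<in> F) \<and> filterlim (\<lambda>n. f n z) at_infinity sequentially}"

definition backward_invariant :: "(complex \<Rightarrow> complex) set \<Rightarrow> complex set \<Rightarrow> bool" where
  "backward_invariant F S \<longleftrightarrow> (\<forall>f\<in>F. f -` S \<subseteq> S)"

end

theory Submission
  imports Defs
begin

text \<open>
  Non-emptiness follows from Eremenko's theorem that a transcendental entire function \<open>f\<close> has an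
  escaping point. If some \<open>w0\<close> with \<open>\<bar>w0\<bar> \<le> 2 r\<close> lay outside \<open>f (cball 0 r)\<close> (that is, in the
  unbounded complementary component), then so would some \<open>w1\<close> with \<open>\<bar>w1\<bar> = 4 r\<close>, and Schottky's
  theorem for \<open>(f - w0) / (w1 - w0)\<close> would bound \<open>f\<close> linearly on \<open>cball 0 (r / 2)\<close>; this is
  impossible for large \<open>r\<close>. Hence, starting from a large disc and alternately applying \<open>f\<close> and
  filling the holes, one gets compact sets \<open>D n\<close> containing discs of radius \<open>2 ^ n * R\<close>. By the
  open mapping theorem \<open>frontier (D (n + 1)) \<subseteq> f ` frontier (D n)\<close>, so by compactness some orbit
  visits all the frontiers, and it escapes.
\<close>

section \<open>Growth of transcendental entire functions\<close>

lemma entire_polynomial_growth_imp_poly: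
  fixes f :: "complex \<Rightarrow> complex"
  assumes hol: "f holomorphic_on UNIV"
    and growth: "\<And>R. \<exists>r\<ge>R. \<forall>z. cmod z = r \<longrightarrow> cmod (f z) \<le> C * r ^ d"
  shows "\<exists>p. f = poly p"
proof -
  define c where "c = (\<lambda>n. (deriv ^^ n) f 0 / fact n)"
  \<comment> \<open>Cauchy's inequality on a circle of radius \<open>r \<ge> R\<close>: for
    \<open>n > d\<close> the power \<open>r ^ n\<close> beats \<open>r ^ d\<close> by at least one
    factor \<open>r\<close>, hence by \<open>R\<close>.\<close>
  have bound: "cmod (c n) * R \<le> \<bar>C\<bar>" if n: "n > d" and R: "R \<ge> 1" for n R
  proof -
    obtain r where r: "r \<ge> R" "\<And>z. cmod z = r \<Longrightarrow> cmod (f z) \<le> C * r ^ d"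
      using growth by blast
    have r1: "r \<ge> 1" using r R by linarith
    have "cmod ((deriv ^^ n) f 0) \<le> fact n * (\<bar>C\<bar> * r ^ d) / r ^ n"
    proof (rule Cauchy_inequality)
      show "f holomorphic_on ball 0 r" using hol holomorphic_on_subset by blast
      show "continuous_on (cball 0 r) f"
        using hol holomorphic_on_imp_continuous_on continuous_on_subset by blast
      show "0 < r" using r1 by simp
      fix x :: complex assume "cmod (0 - x) = r"
      then have "cmod (f x) \<le> C * r ^ d" using r(2)[of x] by simp
      also have "\<dots> \<le> \<bar>C\<bar> * r ^ d" using r1 by (intro mult_right_mono) auto
      finally show "cmod (f x) \<le> \<bar>C\<bar> * r ^ d" .
    qed
    then have "cmod (c n) \<le> \<bar>C\<bar> * r ^ d / r ^ n"
      by (simp add: c_def norm_divide divide_le_eq mult.commute)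
    then have *: "cmod (c n) * r ^ n \<le> \<bar>C\<bar> * r ^ d"
      using r1 by (simp add: le_divide_eq)
    have "cmod (c n) * R * r ^ d \<le> cmod (c n) * (r * r ^ d)"
      using r r1 by (simp add: mult.assoc mult_left_mono mult_right_mono)
    also have "\<dots> \<le> cmod (c n) * r ^ n"
      using power_increasing[of "Suc d" n r] n r1 by (intro mult_left_mono) auto
    finally have "cmod (c n) * R * r ^ d \<le> \<bar>C\<bar> * r ^ d" using * by linarith
    then show ?thesis using r1 by simp
  qed
  have c0: "c n = 0" if "n > d" for n
  proof (rule ccontr)
    assume "c n \<noteq> 0"
    then have pos: "cmod (c n) > 0" by simp
    \<comment> \<open>The value put for \<open>R\<close> makes the product exceed
      \<open>\<bar>C\<bar>\<close>.\<close>
    have "cmod (c n) * (1 + (\<bar>C\<bar> + 1) / cmod (c n)) \<le> \<bar>C\<bar>"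
      using that pos by (intro bound) auto
    then have "cmod (c n) + (\<bar>C\<bar> + 1) \<le> \<bar>C\<bar>"
      using pos by (simp only: distrib_left) simp
    with pos show False by linarith
  qed
  have "f z = poly (\<Sum>k\<le>d. monom (c k) k) z" for z
  proof -
    have "(\<lambda>n. c n * z ^ n) sums f z"
      using holomorphic_power_series[of f 0 "cmod z + 1" z] hol holomorphic_on_subset
      by (fastforce simp: c_def)
    moreover have "(\<lambda>n. c n * z ^ n) sums (\<Sum>k\<le>d. c k * z ^ k)"
      by (rule sums_finite) (auto simp: c0)
    ultimately have "f z = (\<Sum>k\<le>d. c k * z ^ k)" by (rule sums_unique2)
    then show ?thesis by (simp add: poly_sum poly_monom)
  qed
  then show ?thesis by blast
qed

text \<open>The growth hypothesis of the previous lemma asks only for arbitrarily large radii, so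
  its failure for \<open>d = 1\<close> covers every sufficiently large \<open>r\<close>.\<close>

lemma transcendental_entire_growth:
  assumes "transcendental_entire f"
  obtains R where "\<And>r. r \<ge> R \<Longrightarrow> \<exists>z. cmod z = r \<and> cmod (f z) > C * r"
proof -
  have "\<not> (\<forall>R. \<exists>r\<ge>R. \<forall>z. cmod z = r \<longrightarrow> cmod (f z) \<le> C * r ^ 1)"
    using entire_polynomial_growth_imp_poly[of f C 1] assms
    unfolding transcendental_entire_def by blast
  then show thesis using that by (force simp: not_le)
qed

text \<open>Supplies the non-constancy that the open mapping theorem requires.\<close>

lemma transcendental_entire_not_constant:
  assumes "transcendental_entire f"
  shows "\<not> f constant_on UNIV"
proof
  assume "f constant_on UNIV"
  then obtain c where "f = poly [:c:]" by (force simp: constant_on_def)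
  then show False using assms unfolding transcendental_entire_def by blast
qed

section \<open>Filled images of large discs\<close>

lemma outside_norm_attained:
  fixes w :: "'a :: real_normed_vector"
  assumes "w \<in> outside S" "norm w \<le> b"
  obtains v where "v \<notin> S" "norm v = b"
proof -
  let ?T = "connected_component_set (- S) w"
  obtain y where y: "b < norm y" "y \<in> ?T"
    using assms(1) unfolding outside_connected_component_lt by blast
  have w: "w \<in> ?T" using assms(1) by (simp add: outside_def)
  \<comment> \<open>The norm takes every intermediate value on the unbounded component of
    \<open>w\<close>.\<close>
  have "connected (norm ` ?T)"
    by (intro connected_continuous_image continuous_intros) simp
  then have "b \<in> norm ` ?T"
    using connectedD_interval[of "norm ` ?T" "norm w" "norm y" b] w y assms(2) by auto
  then obtain v where "v \<in> ?T" "norm v = b" by auto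
  then show thesis using that connected_component_subset by blast
qed

lemma transcendental_entire_filled_image:
  assumes f: "transcendental_entire f"
  obtains R where "R > 0" "\<And>r. r \<ge> R \<Longrightarrow> cball 0 (2 * r) \<subseteq> - outside (f ` cball 0 r)"
proof -
  \<comment> \<open>Schottky's bound on the disc of radius 1/2 for a function that omits 0 and 1 on
    the closed unit disc and has modulus at most 3/2 at 0.\<close>
  define M where "M = exp (pi * exp (pi * (2 + 2 * (3/2) + 12 * (1/2) / (1 - 1/2))))"
  \<comment> \<open>At radius \<open>r / 2\<close> this growth exceeds
    \<open>2 * r + M * (6 * r)\<close>, exactly the bound that Schottky's theorem will
    impose.\<close>
  obtain R where R: "\<And>r. r \<ge> R \<Longrightarrow> \<exists>z. cmod z = r \<and> cmod (f z) > (4 + 12 * M) * r"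
    using transcendental_entire_growth[OF f] by blast
  have hol: "f holomorphic_on UNIV" using f by (simp add: transcendental_entire_def)
  \<comment> \<open>The term \<open>2 * R\<close> permits the growth estimate at radius
    \<open>r / 2\<close>; the term \<open>cmod (f 0) + 1\<close> makes \<open>r\<close> positive and
    yields \<open>cmod (f 0 - w0) \<le> 3 * r\<close>.\<close>
  have "cball 0 (2 * r) \<subseteq> - outside (f ` cball 0 r)"
    if r: "r \<ge> max (2 * R) (cmod (f 0) + 1)" for r
  proof
    fix w0 :: complex assume "w0 \<in> cball 0 (2 * r)"
    then have w0: "cmod w0 \<le> 2 * r" by simp
    have r0: "r > 0" using r norm_ge_zero[of "f 0"] by linarith
    show "w0 \<in> - outside (f ` cball 0 r)"
    proof
      assume out: "w0 \<in> outside (f ` cball 0 r)"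
      \<comment> \<open>Modulus \<open>4 * r\<close> keeps \<open>w1\<close> at distance between
        \<open>2 * r\<close> and \<open>6 * r\<close> from \<open>w0\<close>.\<close>
      obtain w1 where w1: "w1 \<notin> f ` cball 0 r" "cmod w1 = 4 * r"
        using outside_norm_attained[OF out, of "4 * r"] w0 r0 by auto
      have w0': "w0 \<notin> f ` cball 0 r" using out outside_no_overlap by blast
      have d: "cmod (w1 - w0) \<ge> 2 * r" "cmod (w1 - w0) \<le> 6 * r"
        using w0 w1(2) norm_triangle_ineq2[of w1 w0] norm_triangle_ineq4[of w1 w0] by linarith+
      have ne: "w1 - w0 \<noteq> 0" using d r0 by auto
      \<comment> \<open>Rescales the disc of radius \<open>r\<close> to the unit disc and sends the
        omitted values \<open>w0\<close> and \<open>w1\<close> to 0 and 1.\<close>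
      define g where "g = (\<lambda>z. (f (of_real r * z) - w0) / (w1 - w0))"
      have holg: "g holomorphic_on cball 0 1"
      proof -
        have "(\<lambda>z. f (of_real r * z)) holomorphic_on cball 0 1"
          using holomorphic_on_compose_gen[of "\<lambda>z. of_real r * z" "cball 0 1" f UNIV] hol
          by (auto simp: o_def intro!: holomorphic_intros)
        then show ?thesis unfolding g_def using ne by (intro holomorphic_intros) auto
      qed
      have "cmod (f 0 - w0) \<le> 3 * r"
        using norm_triangle_ineq4[of "f 0" w0] w0 r by linarith
      then have g0: "cmod (g 0) \<le> 3 / 2"
        using d r0 ne by (simp add: g_def norm_divide divide_le_eq)
      have g01: "\<not> (g z = 0 \<or> g z = 1)" if "z \<in> cball 0 1" for z
      proof -
        have "of_real r * z \<in> cball 0 r" using that r0 by (simp add: norm_mult)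
        then have "f (of_real r * z) \<noteq> w0" "f (of_real r * z) \<noteq> w1" using w0' w1(1) by auto
        then show ?thesis using ne by (simp add: g_def)
      qed
      obtain z where z: "cmod z = r / 2" "cmod (f z) > (4 + 12 * M) * (r / 2)"
        using R[of "r / 2"] r by auto
      have "cmod (g (z / of_real r)) \<le> M"
        unfolding M_def by (rule Schottky[OF holg g0 g01]) (use z r0 in \<open>auto simp: norm_divide\<close>)
      then have "cmod (f z - w0) \<le> M * cmod (w1 - w0)"
        using ne r0 by (simp add: g_def norm_divide divide_le_eq)
      also have "\<dots> \<le> M * (6 * r)" using d by (intro mult_left_mono) (auto simp: M_def)
      finally have "cmod (f z) \<le> 2 * r + M * (6 * r)"
        using norm_triangle_ineq2[of "f z" w0] w0 by linarith
      with z(2) show False by (simp add: algebra_simps)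
    qed
  qed
  then show thesis using that[of "max (2 * R) (cmod (f 0) + 1)"]
    by (auto simp: add_nonneg_pos less_max_iff_disj)
qed

lemma compact_filled:
  fixes S :: "'a :: euclidean_space set"
  assumes "compact S"
  shows "compact (- outside S)"
  using assms by (simp add: compact_eq_bounded_closed cobounded_outside open_outside closed_Compl)

text \<open>The image of \<open>K\<close> is closed, so it contains the frontier of its outside.
  Such a frontier point cannot come from the interior of \<open>K\<close>, whose image is open and
  misses the outside, hence also its closure.\<close>

lemma frontier_filled_image_subset:
  fixes f :: "complex \<Rightarrow> complex"
  assumes hol: "f holomorphic_on UNIV" and nc: "\<not> f constant_on UNIV" and K: "compact K"
  shows "frontier (- outside (f ` K)) \<subseteq> f ` frontier K"
proof
  fix w assume "w \<in> frontier (- outside (f ` K))"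
  then have w: "w \<in> frontier (outside (f ` K))" by (simp add: frontier_complement)
  have "closed (f ` K)"
    using K hol holomorphic_on_imp_continuous_on continuous_on_subset
      compact_continuous_image compact_imp_closed by blast
  then obtain z where z: "z \<in> K" "w = f z"
    using frontier_outside_subset w by blast
  have "z \<notin> interior K"
  proof
    assume "z \<in> interior K"
    moreover have "open (f ` interior K)"
      by (rule open_mapping_thm[OF hol _ _ _ _ nc]) auto
    moreover have "f ` interior K \<inter> outside (f ` K) = {}"
      using interior_subset[of K] outside_no_overlap[of "f ` K"] by blast
    ultimately have "w \<notin> closure (outside (f ` K))"
      using z(2) open_Int_closure_eq_empty by blast
    then show False using w by (simp add: frontier_def)
  qed
  then show "w \<in> f ` frontier K" using z closure_subset by (auto simp: frontier_def)
qed

section \<open>Existence of an escaping point\<close>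

lemma transcendental_entire_escaping_point:
  assumes f: "transcendental_entire f"
  obtains z where "filterlim (\<lambda>n. (f ^^ n) z) at_infinity sequentially"
proof -
  obtain R where R: "R > 0" "\<And>r. r \<ge> R \<Longrightarrow> cball 0 (2 * r) \<subseteq> - outside (f ` cball 0 r)"
    using transcendental_entire_filled_image[OF f] by blast
  have hol: "f holomorphic_on UNIV" using f by (simp add: transcendental_entire_def)
  have cont: "continuous_on S f" for S
    using hol holomorphic_on_imp_continuous_on continuous_on_subset by blast
  define D where "D = rec_nat (cball 0 R) (\<lambda>_ K. - outside (f ` K))"
  have D0: "D 0 = cball 0 R" and DS: "D (Suc n) = - outside (f ` D n)" for n
    by (simp_all add: D_def)
  have Dcomp: "compact (D n)" for n
    by (induction n) (simp_all add: D0 DS compact_filled compact_continuous_image cont)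
  have Dball: "cball 0 (2 ^ n * R) \<subseteq> D n" for n
  proof (induction n)
    case (Suc n)
    have "cball 0 (2 * (2 ^ n * R)) \<subseteq> - outside (f ` cball 0 (2 ^ n * R))"
      using R by (intro R(2)) simp
    also have "\<dots> \<subseteq> D (Suc n)"
      unfolding DS using Suc outside_mono[OF image_mono] by blast
    finally show ?case by (simp add: mult.assoc)
  qed (simp add: D0)
  have Dfr: "frontier (D (Suc n)) \<subseteq> f ` frontier (D n)" for n
    unfolding DS
    by (rule frontier_filled_image_subset[OF hol transcendental_entire_not_constant[OF f] Dcomp])
  \<comment> \<open>Lifting step by step along \<open>Dfr\<close>: each frontier point of
    \<open>D n\<close> ends a finite orbit through all earlier frontiers.\<close>
  have pull_back: "\<exists>z. (f ^^ n) z = w \<and> (\<forall>k\<le>n. (f ^^ k) z \<in> frontier (D k))"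
    if "w \<in> frontier (D n)" for n w
    using that
  proof (induction n arbitrary: w)
    case (Suc n)
    obtain v where v: "v \<in> frontier (D n)" "w = f v" using Dfr Suc.prems by blast
    obtain z where "(f ^^ n) z = v" "\<forall>k\<le>n. (f ^^ k) z \<in> frontier (D k)"
      using Suc.IH[OF v(1)] by blast
    then show ?case using v Suc.prems by (intro exI[of _ z]) (auto simp: le_Suc_eq)
  qed simp
  have Dfr_ne: "frontier (D n) \<noteq> {}" for n
  proof (rule frontier_not_empty)
    have "0 \<in> cball 0 (2 ^ n * R)" using R by simp
    then show "D n \<noteq> {}" using Dball by blast
    show "D n \<noteq> UNIV" using Dcomp[of n] by (metis compact_imp_bounded not_bounded_UNIV)
  qed
  \<comment> \<open>Decreasing sets of starting points. The case \<open>k = 0\<close> places them in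
    the compact frontier of \<open>D 0\<close>, and \<open>pull_back\<close> makes them
    non-empty.\<close>
  define A where "A = (\<lambda>n. {z. \<forall>k\<le>n. (f ^^ k) z \<in> frontier (D k)})"
  have contn: "continuous_on UNIV (f ^^ k)" for k
  proof (induction k)
    case (Suc k)
    have "continuous_on UNIV (f \<circ> f ^^ k)" by (intro continuous_on_compose Suc cont)
    then show ?case by (simp only: funpow.simps)
  qed (simp add: id_def)
  have "\<Inter> (range A) \<noteq> {}"
  proof (rule compact_nest)
    fix n
    have "A n = frontier (D 0) \<inter> (\<Inter>k\<in>{..n}. (f ^^ k) -` frontier (D k))"
      by (auto simp: A_def)
    moreover have "closed (\<Inter>k\<in>{..n}. (f ^^ k) -` frontier (D k))"
      by (intro closed_INT ballI closed_vimage contn) auto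
    ultimately show "compact (A n)"
      using Dcomp[of 0] by (simp add: compact_Int_closed compact_frontier)
    show "A n \<noteq> {}" using pull_back Dfr_ne[of n] unfolding A_def by blast
  qed (auto simp: A_def)
  then obtain z where z: "\<And>n. (f ^^ n) z \<in> frontier (D n)" by (auto simp: A_def)
  \<comment> \<open>The open disc of this radius is interior to \<open>D n\<close>, so it contains
    no frontier point.\<close>
  have large: "cmod ((f ^^ n) z) \<ge> 2 ^ n * R" for n
  proof (rule ccontr)
    assume "\<not> ?thesis"
    then have "(f ^^ n) z \<in> ball 0 (2 ^ n * R)" by simp
    moreover have "ball 0 (2 ^ n * R) \<subseteq> interior (D n)"
      using Dball[of n] ball_subset_cball by (intro interior_maximal) auto
    ultimately show False using z[of n] by (auto simp: frontier_def)
  qed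
  have "R * real n \<le> cmod ((f ^^ n) z)" for n
  proof -
    have "real n * R \<le> 2 ^ n * R"
      using R(1) of_nat_less_two_power[of n, where 'a = real] by (intro mult_right_mono) auto
    then show ?thesis using large[of n] by (simp add: mult.commute)
  qed
  then have ev: "eventually (\<lambda>n. R * real n \<le> cmod ((f ^^ n) z)) sequentially"
    by (intro always_eventually allI)
  have "filterlim (\<lambda>n. R * real n) at_top sequentially"
    using R(1) by (intro filterlim_tendsto_pos_mult_at_top[OF tendsto_const] filterlim_real_sequentially)
  then have "filterlim (\<lambda>n. cmod ((f ^^ n) z)) at_top sequentially"
    by (rule filterlim_at_top_mono[OF _ ev])
  then show thesis by (rule that[OF filterlim_norm_at_top_imp_at_infinity])
qed

section \<open>Semigroups and their generalized escaping like sets\<close>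

lemma mem_gen_escaping_like_set_iff:
  "z \<in> gen_escaping_like_set F \<longleftrightarrow> (\<forall>B. \<exists>g\<in>F. cmod (g z) > B)"
proof
  assume "z \<in> gen_escaping_like_set F"
  then obtain f where f: "\<And>n. f n \<in> F" "filterlim (\<lambda>n::nat. f n z) at_infinity sequentially"
    by (auto simp: gen_escaping_like_set_def)
  show "\<forall>B. \<exists>g\<in>F. cmod (g z) > B"
  proof
    fix B
    have "eventually (\<lambda>n. cmod (f n z) > B) sequentially"
      using filterlim_at_infinity_imp_norm_at_top[OF f(2)] by (simp add: filterlim_at_top_dense)
    then show "\<exists>g\<in>F. cmod (g z) > B"
      using f(1) eventually_happens'[OF sequentially_bot] by blast
  qed
next
  assume "\<forall>B. \<exists>g\<in>F. cmod (g z) > B"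
  \<comment> \<open>The terms of the sequence may be picked independently of each other, so
    unboundedness suffices.\<close>
  then have "\<forall>n. \<exists>g\<in>F. cmod (g z) > real n" by blast
  then obtain f where f: "\<And>n. f n \<in> F" "\<And>n. cmod (f n z) > real n" by metis
  have "filterlim (\<lambda>n. cmod (f n z)) at_top sequentially"
    by (rule filterlim_at_top_mono[OF filterlim_real_sequentially])
      (simp add: f(2) less_imp_le)
  then show "z \<in> gen_escaping_like_set F"
    unfolding gen_escaping_like_set_def
    using f(1) filterlim_norm_at_top_imp_at_infinity[of "\<lambda>n. f n z"] by blast
qed

lemma gen_escaping_like_set_nonempty:
  assumes "semigroup_entire F" "f \<in> F" "transcendental_entire f"
  shows "gen_escaping_like_set F \<noteq> {}"
proof -
  obtain z where z: "filterlim (\<lambda>n. (f ^^ n) z) at_infinity sequentially"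
    using transcendental_entire_escaping_point[OF assms(3)] .
  \<comment> \<open>The iterates start at \<open>Suc n\<close> because the zeroth one is the
    identity, which \<open>F\<close> may lack.\<close>
  have "f ^^ Suc n \<in> F" for n
  proof (induction n)
    case (Suc n)
    have "f \<circ> f ^^ Suc n \<in> F"
      using assms Suc unfolding semigroup_entire_def by blast
    then show ?case by (simp only: funpow.simps)
  qed (simp add: assms)
  moreover have "filterlim (\<lambda>n. (f ^^ Suc n) z) at_infinity sequentially"
    using z by (rule filterlim_compose) (rule filterlim_Suc)
  ultimately have "z \<in> gen_escaping_like_set F"
    unfolding gen_escaping_like_set_def
    by (intro CollectI exI[of _ "\<lambda>n. f ^^ Suc n"] conjI allI)
  then show ?thesis by blast
qed

text \<open>Composing on the right with \<open>f\<close> turns values of \<open>F\<close> at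
  \<open>f z\<close> into values of \<open>F\<close> at \<open>z\<close>.\<close>

lemma backward_invariant_gen_escaping_like_set:
  assumes "semigroup_entire F"
  shows "backward_invariant F (gen_escaping_like_set F)"
  unfolding backward_invariant_def
proof (intro ballI subsetI)
  fix f z assume f: "f \<in> F" and "z \<in> f -` gen_escaping_like_set F"
  then have "\<forall>B. \<exists>g\<in>F. cmod (g (f z)) > B" by (simp add: mem_gen_escaping_like_set_iff)
  moreover have "g \<circ> f \<in> F" if "g \<in> F" for g
    using assms f that by (simp add: semigroup_entire_def)
  ultimately show "z \<in> gen_escaping_like_set F"
    unfolding mem_gen_escaping_like_set_iff by (metis comp_apply)
qed

text \<open>Isolates the generator that acts first. In the induction only the right factor is split;
  associativity absorbs the left one into \<open>h\<close>.\<close>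

lemma generated_semigroup_cases_right:
  assumes "g \<in> generated_semigroup G"
  shows "g \<in> G \<or> (\<exists>f\<in>G. \<exists>h\<in>generated_semigroup G. g = h \<circ> f)"
  using assms
proof induction
  case (comp f g)
  then show ?case using generated_semigroup.comp by (metis comp_assoc)
qed simp

text \<open>Every value of the semigroup at \<open>z\<close> is either \<open>f z\<close> or a value
  of the semigroup at \<open>f z\<close>, for some generator \<open>f\<close>. If each of these
  finitely many points had a bounded orbit, so would \<open>z\<close>.\<close>

lemma generator_maps_into_gen_escaping_like_set:
  assumes G: "finite G" and z: "z \<in> gen_escaping_like_set (generated_semigroup G)"
  shows "\<exists>f\<in>G. f z \<in> gen_escaping_like_set (generated_semigroup G)"
proof (rule ccontr)
  assume "\<not> ?thesis"
  then have "\<forall>f\<in>G. \<exists>B. \<forall>h\<in>generated_semigroup G. cmod (h (f z)) \<le> B"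
    by (auto simp: mem_gen_escaping_like_set_iff not_less)
  then obtain B where B: "\<And>f h. f \<in> G \<Longrightarrow> h \<in> generated_semigroup G \<Longrightarrow> cmod (h (f z)) \<le> B f"
    by metis
  \<comment> \<open>One bound for both cases: \<open>B f\<close> controls the compositions in which
    \<open>f\<close> acts first, \<open>cmod (f z)\<close> the bare generator. Non-negative summands
    let the finite sum dominate each of them.\<close>
  define M where "M = (\<Sum>f\<in>G. \<bar>B f\<bar> + cmod (f z))"
  have M: "\<bar>B f\<bar> + cmod (f z) \<le> M" if "f \<in> G" for f
    unfolding M_def using G that by (intro member_le_sum) auto
  obtain g where g: "g \<in> generated_semigroup G" "cmod (g z) > M"
    using z unfolding mem_gen_escaping_like_set_iff by blast
  from generated_semigroup_cases_right[OF g(1)] show False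
  proof
    assume "g \<in> G"
    then show False using M[of g] g(2) by linarith
  next
    assume "\<exists>f\<in>G. \<exists>h\<in>generated_semigroup G. g = h \<circ> f"
    then obtain f h where "f \<in> G" "h \<in> generated_semigroup G" "g = h \<circ> f" by blast
    then have "cmod (g z) \<le> B f" "\<bar>B f\<bar> + cmod (f z) \<le> M" using B M by auto
    then show False using g(2) norm_ge_zero[of "f z"] by linarith
  qed
qed

theorem theorem3p6:
  fixes F :: "(complex \<Rightarrow> complex) set"
  assumes "semigroup_entire F"
    and "\<forall>f\<in>F. transcendental_entire f"
  shows "gen_escaping_like_set F \<noteq> {} \<and>
    backward_invariant F (gen_escaping_like_set F) \<and>
    (\<forall>(m::nat) (f :: nat \<Rightarrow> complex \<Rightarrow> complex).
       (\<forall>i\<in>{1..m}. transcendental_entire (f i)) \<longrightarrow>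
       F = generated_semigroup (f ` {1..m}) \<longrightarrow>
       (\<forall>z\<in>gen_escaping_like_set F. \<exists>i\<in>{1..m}. f i z \<in> gen_escaping_like_set F))"
proof (intro conjI allI impI ballI)
  obtain f where "f \<in> F" using assms(1) unfolding semigroup_entire_def by blast
  then show "gen_escaping_like_set F \<noteq> {}"
    using assms gen_escaping_like_set_nonempty by blast
  show "backward_invariant F (gen_escaping_like_set F)"
    using assms(1) by (rule backward_invariant_gen_escaping_like_set)
next
  fix m :: nat and f :: "nat \<Rightarrow> complex \<Rightarrow> complex" and z
  assume "F = generated_semigroup (f ` {1..m})" "z \<in> gen_escaping_like_set F"
  then show "\<exists>i\<in>{1..m}. f i z \<in> gen_escaping_like_set F"
    using generator_maps_into_gen_escaping_like_set[of "f ` {1..m}" z] by auto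
qed

end
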